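(* Let $\mathcal{A}$ be a Leibniz algebra over a field $F$ and let $B$ be a subinvariant subalgebra of $\mathcal{A}$. If $Z_{\mathcal{A}}(B) = \{0\}$, then $Z_{\mathcal{A}}(B^{\omega}) \subseteq B^{\omega}$.
   Context: A Leibniz algebra over a field $F$ means a finite-dimensional left Leibniz algebra: a finite-dimensional $F$-vector space with a bilinear product $(x,y)\mapsto xy$ such that $x(yz) = (xy)z + y(xz)$ for all $x,y,z$. Ideals are two-sided; $I \vartriangleleft J$ means $I$ is an ideal of $J$. For a Leibniz algebra $B$, set $B^1 = B$, $B^{i} = B B^{i-1}$ (linear span of products) for $i\ge 2$, and $B^{\omega} = \bigcap_{i=1}^{\infty} B^{i}$. A subalgebra $B$ of $\mathcal{A}$ is subinvariant in $\mathcal{A}$ if there is a chain of subalgebras $B = B_t \subset B_{t-1} \subset \cdots \subset B_0 = \mathcal{A}$ with $B_i \vartriangleleft B_{i-1}$ for all $1 \leq i \leq t$. For a subalgebra $C$ of $\mathcal{A}$, the centralizer is $Z_{\mathcal{A}}(C) = \{x \in \mathcal{A} \mid xa = 0 = ax \text{ for all } a \in C\}$. *)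

theory Defs
  imports Complex_Main
begin

text \<open>The algebra is the whole type \<^typ>\<open>'a\<close>, over an arbitrary field \<^typ>\<open>'f\<close>; subspaces,
  subalgebras and ideals are sets.  Finite dimension is stated by the existence of a finite
  spanning set, so that no basis becomes part of the structure.\<close>

locale leibniz_algebra = vector_space scale
  for scale :: "'f::field \<Rightarrow> 'a::ab_group_add \<Rightarrow> 'a" (infixr \<open>*s\<close> 75) +
  fixes mult :: "'a \<Rightarrow> 'a \<Rightarrow> 'a" (infixl \<open>\<cdot>\<close> 70)
  assumes finite_dim: "\<exists>S. finite S \<and> span S = UNIV"
    and linear_right: "\<And>x. Vector_Spaces.linear scale scale (\<lambda>y. x \<cdot> y)"
    and linear_left: "\<And>y. Vector_Spaces.linear scale scale (\<lambda>x. x \<cdot> y)"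
    and left_leibniz: "\<And>x y z. x \<cdot> (y \<cdot> z) = (x \<cdot> y) \<cdot> z + y \<cdot> (x \<cdot> z)"
begin

definition subalgebra :: "'a set \<Rightarrow> bool" where
  "subalgebra B \<longleftrightarrow> subspace B \<and> (\<forall>x\<in>B. \<forall>y\<in>B. x \<cdot> y \<in> B)"

definition ideal_of :: "'a set \<Rightarrow> 'a set \<Rightarrow> bool" where
  "ideal_of I J \<longleftrightarrow> subspace I \<and> I \<subseteq> J \<and> (\<forall>x\<in>J. \<forall>a\<in>I. x \<cdot> a \<in> I \<and> a \<cdot> x \<in> I)"

definition set_prod :: "'a set \<Rightarrow> 'a set \<Rightarrow> 'a set" where
  "set_prod B C = span {x \<cdot> y | x y. x \<in> B \<and> y \<in> C}"

text \<open>\<open>lower_power B i\<close> is \<open>B\<^sup>i\<close>, meaningful for \<open>i \<ge> 1\<close>; the value at \<open>0\<close> is a dummy.\<close>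

fun lower_power :: "'a set \<Rightarrow> nat \<Rightarrow> 'a set" where
  "lower_power B 0 = B"
| "lower_power B (Suc 0) = B"
| "lower_power B (Suc (Suc n)) = set_prod B (lower_power B (Suc n))"

definition omega_power :: "'a set \<Rightarrow> 'a set" where
  "omega_power B = (\<Inter>i\<in>{1..}. lower_power B i)"

definition subinvariant :: "'a set \<Rightarrow> bool" where
  "subinvariant B \<longleftrightarrow>
    (\<exists>(t::nat) C. C 0 = UNIV \<and> C t = B \<and> (\<forall>i\<le>t. subalgebra (C i)) \<and>
      (\<forall>i\<in>{1..t}. ideal_of (C i) (C (i - 1))))"

definition centralizer :: "'a set \<Rightarrow> 'a set" where
  "centralizer C = {x. \<forall>a\<in>C. x \<cdot> a = 0 \<and> a \<cdot> x = 0}"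

end

end

theory Submission
  imports Defs
begin

text \<open>Write \<open>K = B\<^sup>\<omega>\<close>, which equals some \<open>B\<^sup>k\<close>, and let \<open>C\<close> be its centralizer.  Left multiplication
  makes \<open>C\<close> a module over \<open>B\<close> on which \<open>B\<^sup>k\<close> acts as zero.  No nonzero \<open>m \<in> C\<close> satisfies \<open>B m = 0\<close>:
  otherwise descending induction on \<open>n\<close> gives \<open>m B\<^sup>n = 0\<close>, since the elements of \<open>m B\<^sup>n\<close> centralize \<open>B\<close>
  as soon as \<open>m B\<^bsup>n+1\<^esup> = 0\<close>.  For a nilpotent action on a finite-dimensional module, the absence of
  invariants forces \<open>C = B C\<close>.  Multiplying by \<open>B\<close> moves down the chain from the whole algebra to \<open>B\<close>
  and then down the lower powers of \<open>B\<close>, so \<open>C \<subseteq> K\<close>.\<close>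

context leibniz_algebra
begin

section \<open>Bilinearity and finite dimension\<close>

lemma mult_add_right: "x \<cdot> (y + z) = x \<cdot> y + x \<cdot> z"
  using linear_right by (rule Vector_Spaces.linear.axioms(3)[THEN module_hom.add])

lemma mult_add_left: "(x + y) \<cdot> z = x \<cdot> z + y \<cdot> z"
  using linear_left by (rule Vector_Spaces.linear.axioms(3)[THEN module_hom.add])

lemma mult_scale_right: "x \<cdot> (c *s y) = c *s (x \<cdot> y)"
  using linear_right by (rule Vector_Spaces.linear.axioms(3)[THEN module_hom.scale])

lemma mult_scale_left: "(c *s x) \<cdot> y = c *s (x \<cdot> y)"
  using linear_left by (rule Vector_Spaces.linear.axioms(3)[THEN module_hom.scale])

lemma mult_zero_right [simp]: "x \<cdot> 0 = 0"
  using mult_scale_right[of x 0 0] by simp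

lemma mult_zero_left [simp]: "0 \<cdot> x = 0"
  using mult_scale_left[of 0 0 x] by simp

lemma mult_mult_left: "(x \<cdot> y) \<cdot> z = x \<cdot> (y \<cdot> z) - y \<cdot> (x \<cdot> z)"
  using left_leibniz[of x y z] by simp

lemma subspace_vimage_mult_right: "subspace W \<Longrightarrow> subspace {y. x \<cdot> y \<in> W}"
  by (auto simp: subspace_def mult_add_right mult_scale_right)

lemma subspace_vimage_mult_left: "subspace W \<Longrightarrow> subspace {x. x \<cdot> y \<in> W}"
  by (auto simp: subspace_def mult_add_left mult_scale_left)

lemma subspace_image_mult: "subspace V \<Longrightarrow> subspace ((\<cdot>) x ` V)"
  by (rule module_hom.subspace_image[OF Vector_Spaces.linear.axioms(3)[OF linear_right]])

text \<open>A maximal independent subset of a finite spanning set is a finite basis; it makes the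
  dimension theory of \<open>finite_dimensional_vector_space\<close> available inside the
  proof.\<close>

lemma subspace_psubset_dim_less:
  assumes "subspace U" "subspace W" "U \<subset> W"
  shows "dim U < dim W"
proof -
  obtain S where S: "finite S" "span S = UNIV"
    using finite_dim by blast
  obtain Bs where Bs: "Bs \<subseteq> S" "independent Bs" "S \<subseteq> span Bs"
    using maximal_independent_subset[of S] by blast
  have "span Bs = UNIV"
    using S(2) span_mono[OF Bs(3)] unfolding span_span by blast
  then interpret finite_dimensional_vector_space scale Bs
    using S(1) Bs(1,2) by unfold_locales (auto intro: finite_subset)
  show ?thesis
    using assms by (metis dim_psubset span_eq_iff)
qed

section \<open>Products and lower powers\<close>

lemma set_prod_memI: "x \<in> B \<Longrightarrow> y \<in> C \<Longrightarrow> x \<cdot> y \<in> set_prod B C"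
  unfolding set_prod_def by (rule span_base) blast

lemma subspace_set_prod: "subspace (set_prod B C)"
  unfolding set_prod_def by simp

lemma set_prod_subsetI:
  assumes "subspace W" "\<And>x y. x \<in> B \<Longrightarrow> y \<in> C \<Longrightarrow> x \<cdot> y \<in> W"
  shows "set_prod B C \<subseteq> W"
  unfolding set_prod_def using assms by (intro span_minimal) auto

lemma set_prod_mono_right: "C \<subseteq> D \<Longrightarrow> set_prod B C \<subseteq> set_prod B D"
  by (intro set_prod_subsetI subspace_set_prod set_prod_memI) auto

lemma subspace_lower_power: "subspace B \<Longrightarrow> subspace (lower_power B n)"
  by (cases "(B, n)" rule: lower_power.cases) (auto simp: subspace_set_prod)

lemma lower_power_Suc_subset:
  assumes "subalgebra B"
  shows "lower_power B (Suc (Suc n)) \<subseteq> lower_power B (Suc n)"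
proof (induction n)
  case 0
  then show ?case
    using assms by (simp add: subalgebra_def set_prod_subsetI)
next
  case (Suc n)
  then show ?case
    using set_prod_mono_right by simp
qed

lemma lower_power_antimono:
  assumes "subalgebra B" "m \<le> n"
  shows "lower_power B (Suc n) \<subseteq> lower_power B (Suc m)"
  using assms(2) lower_power_Suc_subset[OF assms(1)]
  by (rule lift_Suc_antimono_le[of "\<lambda>n. lower_power B (Suc n)", rotated])

lemma lower_power_subset: "subalgebra B \<Longrightarrow> lower_power B (Suc n) \<subseteq> B"
  using lower_power_antimono[of B 0 n] by simp

lemma mult_lower_power_mem:
  "x \<in> B \<Longrightarrow> y \<in> lower_power B (Suc n) \<Longrightarrow> x \<cdot> y \<in> lower_power B (Suc (Suc n))"
  by (simp add: set_prod_memI)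

text \<open>Induction on the left index, through \<open>(b \<cdot> c) \<cdot> y = b \<cdot> (c
  \<cdot> y) - c \<cdot> (b \<cdot> y)\<close>. This controls multiplication by \<open>B\<close> on
  the right, although the powers are built by multiplying on the left.\<close>

lemma lower_power_mult_lower_power_mem:
  assumes "subspace B" "x \<in> lower_power B (Suc i)" "y \<in> lower_power B (Suc j)"
  shows "x \<cdot> y \<in> lower_power B (Suc (Suc (i + j)))"
  using assms(2,3)
proof (induction i arbitrary: x y j)
  case 0
  then show ?case
    by (simp add: set_prod_memI)
next
  case (Suc i)
  let ?W = "lower_power B (Suc (Suc (Suc i + j)))"
  have W: "subspace ?W"
    by (rule subspace_lower_power[OF assms(1)])
  have "set_prod B (lower_power B (Suc i)) \<subseteq> {x. x \<cdot> y \<in> ?W}"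
  proof (rule set_prod_subsetI[OF subspace_vimage_mult_left[OF W]], rule CollectI)
    fix b c
    assume b: "b \<in> B" and c: "c \<in> lower_power B (Suc i)"
    have "b \<cdot> (c \<cdot> y) \<in> ?W"
      using mult_lower_power_mem[OF b Suc.IH[OF c Suc.prems(2)]] by simp
    \<comment> \<open>Here \<open>b \<cdot> y\<close> lies one power deeper, so the hypothesis is
      applied at \<open>Suc j\<close>.\<close>
    moreover have "c \<cdot> (b \<cdot> y) \<in> ?W"
      using Suc.IH[OF c mult_lower_power_mem[OF b Suc.prems(2)]] by simp
    ultimately show "(b \<cdot> c) \<cdot> y \<in> ?W"
      unfolding mult_mult_left by (rule subspace_diff[OF W])
  qed
  then show ?case
    using Suc.prems(1) by auto
qed

lemma omega_power_eq_lower_power: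
  assumes "subalgebra B"
  obtains k where "omega_power B = lower_power B (Suc k)"
proof -
  let ?P = "\<lambda>n. lower_power B (Suc n)"
  have sub: "subspace (?P n)" for n
    using assms by (intro subspace_lower_power) (simp add: subalgebra_def)
  \<comment> \<open>A power of least dimension: the descending chain cannot drop strictly below
    it.\<close>
  obtain k where k: "\<And>n. dim (?P k) \<le> dim (?P n)"
    using ex_has_least_nat[of "\<lambda>_. True" _ "\<lambda>n. dim (?P n)"] by auto
  have "?P k \<subseteq> ?P n" for n
  proof (cases "n \<le> k")
    case True
    then show ?thesis
      by (rule lower_power_antimono[OF assms])
  next
    case False
    then have "?P n \<subseteq> ?P k"
      by (intro lower_power_antimono[OF assms]) simp
    then show ?thesis
      using subspace_psubset_dim_less[OF sub sub, of n k] k[of n] by auto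
  qed
  moreover have "omega_power B = (\<Inter>n. ?P n)"
    unfolding omega_power_def
    by (metis atLeast_Suc_greaterThan One_nat_def greaterThan_0 image_image)
  ultimately show ?thesis
    using that[of k] by blast
qed

section \<open>Nilpotent actions without invariants\<close>

text \<open>Some \<open>x\<close> in the last lower power that acts nontrivially on \<open>V\<close> acts by a nonzero endomorphism of
  the module; the induction hypothesis applies to its kernel and to its image.\<close>

lemma subset_set_prod_if_no_invariants:
  assumes B: "subalgebra B"
    and "subspace V"
    and "\<And>b v. b \<in> B \<Longrightarrow> v \<in> V \<Longrightarrow> b \<cdot> v \<in> V"
    and "\<And>x v. x \<in> lower_power B (Suc k) \<Longrightarrow> v \<in> V \<Longrightarrow> x \<cdot> v = 0"
    and "\<And>v. v \<in> V \<Longrightarrow> (\<And>b. b \<in> B \<Longrightarrow> b \<cdot> v = 0) \<Longrightarrow> v = 0"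
  shows "V \<subseteq> set_prod B V"
  using assms(2-)
proof (induction "dim V" arbitrary: V rule: less_induct)
  case less
  note sub = less.prems(1) and inv = less.prems(2) and nil = less.prems(3)
    and noinv = less.prems(4)
  have subBV: "subspace (set_prod B V)"
    by (rule subspace_set_prod)
  define Q where "Q n \<longleftrightarrow> (\<forall>x \<in> lower_power B (Suc n). \<forall>v \<in> V. x \<cdot> v = 0)" for n
  have "Q k"
    using nil by (simp add: Q_def)
  show ?case
  proof (cases "Q 0")
    case True
    then show ?thesis
      using noinv subspace_0[OF subBV] by (auto simp: Q_def)
  next
    case False
    \<comment> \<open>\<open>Q\<close> fails at \<open>0\<close> and holds at \<open>k\<close>, so
      it switches in between.\<close>
    have "\<exists>j. \<not> Q j \<and> Q (Suc j)"
      using \<open>Q k\<close> by (induction k) (use False in blast)+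
    then obtain j where j: "\<not> Q j" "Q (Suc j)"
      by blast
    then obtain x u where x: "x \<in> lower_power B (Suc j)" and u: "u \<in> V" "x \<cdot> u \<noteq> 0"
      by (auto simp: Q_def)
    have xB: "x \<in> B"
      using x lower_power_subset[OF B] by blast
    \<comment> \<open>\<open>b \<cdot> x\<close> lies in the next power, which annihilates
      \<open>V\<close>; the Leibniz identity thus reduces to commutation.\<close>
    have comm: "b \<cdot> (x \<cdot> v) = x \<cdot> (b \<cdot> v)" if "b \<in> B" "v \<in> V" for b v
      using j(2) mult_lower_power_mem[OF that(1) x] that(2) left_leibniz[of b x v]
      by (simp add: Q_def)
    let ?I = "(\<cdot>) x ` V" and ?N = "{v \<in> V. x \<cdot> v = 0}"
    have I_sub: "?I \<subseteq> V"
      using inv xB by auto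
    show ?thesis
    \<comment> \<open>If \<open>x\<close> maps \<open>V\<close> onto itself, then
      \<open>V = x V \<subseteq> B V\<close> at once; otherwise image and kernel both have smaller
      dimension.\<close>
    proof (cases "?I = V")
      case True
      then show ?thesis
        using xB by (metis image_subsetI set_prod_memI)
    next
      case False
      have subI: "subspace ?I"
        by (rule subspace_image_mult[OF sub])
      have subN: "subspace ?N"
        using subspace_inter[OF sub subspace_vimage_mult_right[OF subspace_single_0, of x]]
        by (simp add: Int_def)
      have "dim ?I < dim V"
        using False I_sub by (intro subspace_psubset_dim_less[OF subI sub]) blast
      then have I: "?I \<subseteq> set_prod B ?I"
      proof (rule less.hyps[OF _ subI])
        show "b \<cdot> v \<in> ?I" if "b \<in> B" "v \<in> ?I" for b v
          using that comm inv by auto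
      qed (use I_sub nil noinv in blast)+
      have "dim ?N < dim V"
        using u by (intro subspace_psubset_dim_less[OF subN sub]) blast
      then have "?N \<subseteq> set_prod B ?N"
      proof (rule less.hyps[OF _ subN])
        show "b \<cdot> v \<in> ?N" if "b \<in> B" "v \<in> ?N" for b v
          using that comm[of b v] inv by auto
      qed (use nil noinv in blast)+
      then have N: "?N \<subseteq> set_prod B V"
        using set_prod_mono_right[of ?N V B] by blast
      have BV_sub: "set_prod B V \<subseteq> V"
        using inv by (intro set_prod_subsetI sub)
      \<comment> \<open>By commutation \<open>B (x V) \<subseteq> x (B V)\<close>. Hence every
        \<open>v\<close> agrees with some \<open>w\<close> in \<open>B V\<close> up to an element of
        the kernel, and the kernel lies in \<open>B V\<close> too.\<close>
      have "set_prod B ?I \<subseteq> (\<cdot>) x ` set_prod B V"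
      proof (rule set_prod_subsetI[OF subspace_image_mult[OF subBV]])
        show "b \<cdot> w \<in> (\<cdot>) x ` set_prod B V" if "b \<in> B" "w \<in> ?I" for b w
          using that comm by (auto intro: set_prod_memI)
      qed
      with I have xV: "?I \<subseteq> (\<cdot>) x ` set_prod B V"
        by blast
      show ?thesis
      proof
        fix v
        assume v: "v \<in> V"
        then obtain w where w: "w \<in> set_prod B V" "x \<cdot> v = x \<cdot> w"
          using xV by blast
        have "x \<cdot> (v - w) = 0"
          using w(2) mult_add_right[of x "v - w" w] by simp
        then have "v - w \<in> ?N"
          using v w(1) BV_sub subspace_diff[OF sub] by blast
        then have "(v - w) + w \<in> set_prod B V"
          using N w(1) subspace_add[OF subBV] by blast
        then show "v \<in> set_prod B V"
          by simp
      qed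
    qed
  qed
qed

section \<open>Centralizers as modules\<close>

lemma subspace_centralizer: "subspace (centralizer K)"
  by (auto simp: centralizer_def subspace_def mult_add_left mult_add_right
      mult_scale_left mult_scale_right)

text \<open>Both products expand by the Leibniz identity: \<open>(b \<cdot> x) \<cdot> a\<close>
  needs \<open>b \<cdot> a\<close> in \<open>K\<close>, and \<open>a \<cdot> (b \<cdot> x)\<close>
  needs \<open>a \<cdot> b\<close> in \<open>K\<close>.\<close>

lemma mult_centralizer_mem:
  assumes "\<And>a. a \<in> K \<Longrightarrow> b \<cdot> a \<in> K" "\<And>a. a \<in> K \<Longrightarrow> a \<cdot> b \<in> K" "x \<in> centralizer K"
  shows "b \<cdot> x \<in> centralizer K"
  unfolding centralizer_def
proof (intro CollectI ballI conjI)
  fix a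
  assume a: "a \<in> K"
  have x: "x \<cdot> c = 0" "c \<cdot> x = 0" if "c \<in> K" for c
    using assms(3) that by (auto simp: centralizer_def)
  show "(b \<cdot> x) \<cdot> a = 0"
    using x a assms(1) by (simp add: mult_mult_left)
  show "a \<cdot> (b \<cdot> x) = 0"
    using x a assms(2) by (simp add: left_leibniz[of a b x])
qed

lemma centralizer_lower_power_no_invariants:
  assumes B: "subalgebra B" and Z: "centralizer B = {0}"
    and m: "m \<in> centralizer (lower_power B (Suc k))"
    and Bm: "\<And>b. b \<in> B \<Longrightarrow> b \<cdot> m = 0"
  shows "m = 0"
proof -
  have "\<forall>c \<in> lower_power B (Suc 0). m \<cdot> c = 0"
  proof (rule inc_induct[of 0 k])
    show "\<forall>c \<in> lower_power B (Suc k). m \<cdot> c = 0"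
      using m by (simp add: centralizer_def)
  next
    fix n
    assume IH: "\<forall>c \<in> lower_power B (Suc (Suc n)). m \<cdot> c = 0"
    show "\<forall>c \<in> lower_power B (Suc n). m \<cdot> c = 0"
    proof
      fix c
      assume c: "c \<in> lower_power B (Suc n)"
      then have cB: "c \<in> B"
        using lower_power_subset[OF B] by blast
      have "m \<cdot> c \<in> centralizer B"
        unfolding centralizer_def
      proof (intro CollectI ballI conjI)
        fix a
        assume a: "a \<in> B"
        have "m \<cdot> (c \<cdot> a) = 0"
          using IH lower_power_mult_lower_power_mem[OF _ c, of a 0] a B
          by (simp add: subalgebra_def)
        \<comment> \<open>The remaining term \<open>c \<cdot> (m \<cdot> a)\<close> equals
          \<open>(c \<cdot> m) \<cdot> a + m \<cdot> (c \<cdot> a)\<close>, where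
          \<open>c \<cdot> m = 0\<close> because \<open>c\<close> is in \<open>B\<close>.\<close>
        then show "(m \<cdot> c) \<cdot> a = 0"
          using left_leibniz[of c m a] Bm[OF cB] by (simp add: mult_mult_left)
        have "m \<cdot> (a \<cdot> c) = 0"
          using IH mult_lower_power_mem[OF a c] by simp
        then show "a \<cdot> (m \<cdot> c) = 0"
          using Bm[OF a] by (simp add: left_leibniz[of a m c])
      qed
      then show "m \<cdot> c = 0"
        using Z by simp
    qed
  qed simp
  then have "m \<in> centralizer B"
    using Bm by (simp add: centralizer_def)
  then show ?thesis
    using Z by simp
qed

section \<open>Descent to \<open>B\<close> and through its lower powers\<close>

lemma subset_if_subinvariant:
  assumes "subinvariant B" "V \<subseteq> set_prod B V"
  shows "V \<subseteq> B"
proof -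
  obtain t :: nat and C where C: "C 0 = UNIV" "C t = B"
    and ideal: "\<And>i. i \<in> {1..t} \<Longrightarrow> ideal_of (C i) (C (i - 1))"
    using assms(1) unfolding subinvariant_def by blast
  have ideal_Suc: "ideal_of (C (Suc i)) (C i)" if "i < t" for i
    using ideal[of "Suc i"] that by simp
  have B_sub: "B \<subseteq> C i" if "i \<le> t" for i
    using that
  proof (induction rule: inc_induct)
    case (step i)
    then show ?case
      using ideal_Suc[of i] by (auto simp: ideal_of_def)
  qed (simp add: C(2))
  \<comment> \<open>From \<open>V \<subseteq> C i\<close> follows
    \<open>B V \<subseteq> C (Suc i)\<close>, since \<open>B\<close> lies in
    \<open>C (Suc i)\<close>, an ideal of \<open>C i\<close>.\<close>
  have "V \<subseteq> C i" if "i \<le> t" for i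
    using that
  proof (induction i)
    case 0
    then show ?case
      by (simp add: C(1))
  next
    case (Suc i)
    then have "set_prod B V \<subseteq> C (Suc i)"
      using ideal_Suc[of i] B_sub[of "Suc i"]
      by (intro set_prod_subsetI) (auto simp: ideal_of_def subset_iff)
    then show ?case
      using assms(2) by blast
  qed
  then show ?thesis
    using C(2) by blast
qed

lemma subset_lower_power:
  assumes "V \<subseteq> B" "V \<subseteq> set_prod B V"
  shows "V \<subseteq> lower_power B (Suc n)"
proof (induction n)
  case (Suc n)
  then show ?case
    using assms(2) set_prod_mono_right[OF Suc, of B] by simp
qed (simp add: assms(1))

section \<open>The centralizer of \<open>B\<^sup>\<omega>\<close>\<close>

lemma centralizer_omega_power_subset:
  assumes B: "subalgebra B" and "subinvariant B" and Z: "centralizer B = {0}"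
  shows "centralizer (omega_power B) \<subseteq> omega_power B"
proof -
  obtain k where k: "omega_power B = lower_power B (Suc k)"
    using omega_power_eq_lower_power[OF B] .
  let ?K = "lower_power B (Suc k)"
  \<comment> \<open>Either product lands in the power after \<open>?K\<close>, which is contained in
    \<open>?K\<close>.\<close>
  have ideal: "b \<cdot> a \<in> ?K" "a \<cdot> b \<in> ?K" if "a \<in> ?K" "b \<in> B" for a b
    using that mult_lower_power_mem[of b B a k] lower_power_Suc_subset[OF B, of k]
      lower_power_mult_lower_power_mem[of B a k b 0] B
    by (auto simp: subalgebra_def)
  have "centralizer ?K \<subseteq> set_prod B (centralizer ?K)"
  proof (rule subset_set_prod_if_no_invariants[OF B subspace_centralizer])
    show "b \<cdot> v \<in> centralizer ?K" if "b \<in> B" "v \<in> centralizer ?K" for b v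
      using that ideal by (intro mult_centralizer_mem) auto
    show "x \<cdot> v = 0" if "x \<in> ?K" "v \<in> centralizer ?K" for x v
      using that by (simp add: centralizer_def)
    show "v = 0" if "v \<in> centralizer ?K" "\<And>b. b \<in> B \<Longrightarrow> b \<cdot> v = 0" for v
      using centralizer_lower_power_no_invariants[OF B Z that] .
  qed
  then show ?thesis
    unfolding k using subset_lower_power subset_if_subinvariant[OF assms(2)] by blast
qed

end

theorem theorem2p9:
  fixes scale :: "'f::field \<Rightarrow> 'a::ab_group_add \<Rightarrow> 'a"
    and mult :: "'a \<Rightarrow> 'a \<Rightarrow> 'a"
    and B :: "'a set"
  assumes "leibniz_algebra scale mult"
    and "leibniz_algebra.subalgebra scale mult B"
    and "leibniz_algebra.subinvariant scale mult B"
    and "leibniz_algebra.centralizer mult B = {0}"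
  shows "leibniz_algebra.centralizer mult (leibniz_algebra.omega_power scale mult B)
    \<subseteq> leibniz_algebra.omega_power scale mult B"
  using assms by (rule leibniz_algebra.centralizer_omega_power_subset)

end
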